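(* Let $\Omega \subseteq \mathbb{R}^d$ be a lattice of full rank and determinant $\Delta$, let $\Lambda_1,\dots,\Lambda_s \subseteq \Omega$ be sublattices with indices $[\Omega:\Lambda_i] = D_i$ for each $1 \leq i \leq s$, and let $\Lambda = \bigcap_{i=1}^s \Lambda_i$, a sublattice of $\Omega$ of index $D \leq D_1 \cdots D_s$. Assume that $\Omega \not\subseteq \bigcup_{i=1}^s \Lambda_i$. Let $P(x_1,\dots,x_d) \in \mathbb{R}[x_1,\dots,x_d]$ be a polynomial of degree $m$. Then there exists a point $\boldsymbol{z} \in \Omega \setminus \bigcup_{i=1}^s \Lambda_i$ such that $$P(\boldsymbol{z}) \neq 0,\quad z_i \geq 0\ \text{ for all } 1 \leq i \leq d,$$ and $$|\boldsymbol{z}| < D (m + 2 ) (\mu(\Lambda)+1) \left( \frac{D \Delta}{\lambda_1(\Lambda)^{d-1}} \left( \sum_{i=1}^s \frac{1}{D_i} - \frac{s - 1}{D} + \frac{\lambda_1(\Lambda)^d}{D\Delta} \right) + \sum_{i=1}^d \lambda_i(\Lambda) \right).$$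
   Context: For $\boldsymbol{z} \in \mathbb{R}^d$, $|\boldsymbol{z}| = \max_i |z_i|$ is the sup-norm and $C_d(T) = \{\boldsymbol{z} : |\boldsymbol{z}| \leq T\}$. For a full-rank lattice $L \subset \mathbb{R}^d$, $\lambda_i(L) = \min\{T > 0 : \dim_{\mathbb{R}} \operatorname{span}_{\mathbb{R}}(C_d(T) \cap L) \geq i\}$ are its successive minima with respect to $C_d(1)$. The covering radius of $\Lambda$ is $\mu(\Lambda) = \min\{T > 0 : B_d(T) + \Lambda = \mathbb{R}^d\}$, where $B_d(T)$ is the Euclidean ball of radius $T$ centered at the origin. *)

theory Defs
  imports "HOL-Analysis.Analysis" "HOL-Library.Poly_Mapping"
begin

section \<open>Full-rank lattices in Euclidean space\<close>

text \<open>The columns of \<open>B\<close> form a \<open>\<int>\<close>-basis of \<open>L\<close>.\<close>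

definition lattice_basis :: "real^'n^'n \<Rightarrow> (real^'n) set \<Rightarrow> bool" where
  "lattice_basis B L \<longleftrightarrow>
     invertible B \<and> L = range (\<lambda>c::int^'n. B *v (\<chi> i. real_of_int (c $ i)))"

definition full_rank_lattice :: "(real^'n) set \<Rightarrow> bool" where
  "full_rank_lattice L \<longleftrightarrow> (\<exists>B. lattice_basis B L)"

text \<open>Independence of the chosen basis is \<open>lattice_det_eq\<close> below.\<close>

definition lattice_det :: "(real^'n) set \<Rightarrow> real" where
  "lattice_det L = \<bar>det (SOME B. lattice_basis B L)\<bar>"

lemma lattice_basis_abs_det_le:
  fixes B B' :: "real^'n^'n"
  assumes B: "lattice_basis B L" and B': "lattice_basis B' L"
  shows "\<bar>det B\<bar> \<le> \<bar>det B'\<bar>"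
proof -
  have "\<exists>c::int^'n. column j B' = B *v (\<chi> i. real_of_int (c $ i))" for j
  proof -
    have "column j B' = B' *v (\<chi> i. real_of_int ((axis j 1 :: int^'n) $ i))"
      by (simp add: vec_eq_iff matrix_vector_mult_def column_def axis_def if_distrib cong: if_cong)
    then have "column j B' \<in> L"
      using B' by (auto simp: lattice_basis_def)
    then show ?thesis
      using B by (auto simp: lattice_basis_def)
  qed
  then obtain c :: "'n \<Rightarrow> int^'n"
    where c: "\<And>j. column j B' = B *v (\<chi> i. real_of_int (c j $ i))"
    by metis
  define U :: "real^'n^'n" where "U = (\<chi> i j. real_of_int (c j $ i))"
  have "B' $ i $ j = (B ** U) $ i $ j" for i j
    using arg_cong[OF c[of j], of "\<lambda>v. v $ i"]
    by (simp add: column_def matrix_vector_mult_def matrix_matrix_mult_def U_def)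
  then have "B' = B ** U"
    by (simp add: vec_eq_iff)
  then have detB': "det B' = det B * det U"
    by (simp add: det_mul)
  have "det B' \<noteq> 0"
    using B' by (simp add: lattice_basis_def invertible_det_nz)
  then have "det U \<noteq> 0"
    using detB' by auto
  moreover have "det U \<in> \<int>"
    unfolding det_def U_def by (intro Ints_sum Ints_mult Ints_prod) auto
  ultimately have "1 \<le> \<bar>det U\<bar>"
    by (metis Ints_nonzero_abs_ge1)
  then show ?thesis
    by (simp add: detB' abs_mult mult_le_cancel_left1)
qed

lemma lattice_det_eq:
  assumes "lattice_basis B L"
  shows "lattice_det L = \<bar>det B\<bar>"
proof -
  have "lattice_basis (SOME B. lattice_basis B L) L"
    using assms by (rule someI)
  then show ?thesis
    unfolding lattice_det_def using assms by (intro antisym lattice_basis_abs_det_le)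
qed

text \<open>The index \<open>[L : M]\<close> as the number of cosets; it is \<open>0\<close> if there are infinitely many,
  which does not happen when \<open>M \<subseteq> L\<close> are both full-rank lattices.\<close>

definition lattice_index :: "(real^'n) set \<Rightarrow> (real^'n) set \<Rightarrow> nat" where
  "lattice_index L M = card ((\<lambda>x. (+) x ` M) ` L)"

definition cube :: "real \<Rightarrow> (real^'n) set" where
  "cube T = {z. infnorm z \<le> T}"

text \<open>On \<open>real\<close>, \<open>LEAST\<close> denotes the minimum of a set, which exists here for full-rank
  lattices (and \<open>1 \<le> i \<le> d\<close> in the case of the successive minima).\<close>

definition successive_min :: "(real^'n) set \<Rightarrow> nat \<Rightarrow> real" where
  "successive_min L i = (LEAST T. 0 < T \<and> i \<le> dim (span (cube T \<inter> L)))"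

definition covering_radius :: "(real^'n) set \<Rightarrow> real" where
  "covering_radius L = (LEAST T. 0 < T \<and> {b + l | b l. b \<in> cball 0 T \<and> l \<in> L} = UNIV)"


section \<open>Polynomials in finitely many variables\<close>

text \<open>A polynomial maps finitely many monomials (exponent vectors) to nonzero coefficients.\<close>

type_synonym 'n rpoly = "('n \<Rightarrow>\<^sub>0 nat) \<Rightarrow>\<^sub>0 real"

definition rpoly_eval :: "('n::finite) rpoly \<Rightarrow> real^'n \<Rightarrow> real" where
  "rpoly_eval P z =
     (\<Sum>a\<in>Poly_Mapping.keys P. Poly_Mapping.lookup P a * (\<Prod>i\<in>UNIV. z $ i ^ Poly_Mapping.lookup a i))"

text \<open>Total degree; by convention \<open>0\<close> for the zero polynomial.\<close>

definition rpoly_degree :: "('n::finite) rpoly \<Rightarrow> nat" where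
  "rpoly_degree P = Max (insert 0 ((\<lambda>a. \<Sum>i\<in>UNIV. Poly_Mapping.lookup a i) ` Poly_Mapping.keys P))"

end

theory Submission
  imports Defs "HOL-Computational_Algebra.Polynomial"
begin

text \<open>If \<open>x\<close> lies in \<open>\<Omega>\<close> but in no \<open>\<Lambda>\<^sub>i\<close>, then so does the whole coset \<open>x + \<Lambda>\<close>. Linearly
  independent \<open>w\<^sub>1, \<dots>, w\<^sub>d \<in> \<Lambda>\<close> with \<open>\<bar>w\<^sub>i\<bar> \<le> \<lambda>\<^sub>i\<close> generate a grid in this coset with
  \<open>m + 1\<close> points in each direction. The grid can be placed inside the cube of side
  \<open>(m + 1) (\<lambda>\<^sub>1 + \<dots> + \<lambda>\<^sub>d)\<close> in the positive orthant, and a nonzero polynomial of degree \<open>m\<close> does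
  not vanish on all of it. The side is smaller than the bound of the theorem, since \<open>\<mu> > 0\<close> and
  \<open>D\<^sub>i \<le> D\<close> makes the term multiplied by \<open>D \<Delta> / \<lambda>\<^sub>1\<^bsup>d-1\<^esup>\<close> positive.\<close>

section \<open>Sublattices\<close>

text \<open>Coordinates with respect to \<open>B\<close> are real a priori. Describing lattice
  points by integral entries lets Cramer's rule and rounding decide membership.\<close>

lemma lattice_basis_iff:
  "lattice_basis B L \<longleftrightarrow> invertible B \<and> L = (*v) B ` {x. \<forall>i. x $ i \<in> \<int>}"
proof -
  have "range (\<lambda>c::int^'a. (\<chi> i. real_of_int (c $ i))) = {x. \<forall>i. x $ i \<in> \<int>}"
  proof (intro equalityI subsetI)
    fix x :: "real^'a" assume "x \<in> {x. \<forall>i. x $ i \<in> \<int>}"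
    then have "x = (\<chi> i. real_of_int ((\<chi> i. \<lfloor>x $ i\<rfloor>) $ i))"
      by (simp add: vec_eq_iff)
    then show "x \<in> range (\<lambda>c::int^'a. (\<chi> i. real_of_int (c $ i)))"
      by (rule range_eqI)
  qed auto
  then show ?thesis
    unfolding lattice_basis_def by (metis image_image)
qed

lemma full_rank_lattice_obtain:
  fixes L :: "(real^'n) set"
  assumes "full_rank_lattice L"
  obtains B :: "real^'n^'n" where "det B \<noteq> 0" "L = (*v) B ` {x. \<forall>i. x $ i \<in> \<int>}"
  using assms unfolding full_rank_lattice_def lattice_basis_iff invertible_det_nz by blast

text \<open>Cosets and indices need the group structure only, and the intersection \<Lambda> has it
  before it is known to be a lattice.\<close>

definition add_subgroup :: "'a::ab_group_add set \<Rightarrow> bool" where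
  "add_subgroup M \<longleftrightarrow> 0 \<in> M \<and> (\<forall>x\<in>M. \<forall>y\<in>M. x - y \<in> M)"

lemma add_subgroupD:
  assumes "add_subgroup M"
  shows "0 \<in> M" "x \<in> M \<Longrightarrow> y \<in> M \<Longrightarrow> x - y \<in> M" "x \<in> M \<Longrightarrow> - x \<in> M"
    "x \<in> M \<Longrightarrow> y \<in> M \<Longrightarrow> x + y \<in> M"
proof -
  show z: "0 \<in> M" and d: "x \<in> M \<Longrightarrow> y \<in> M \<Longrightarrow> x - y \<in> M" for x y
    using assms by (auto simp: add_subgroup_def)
  show m: "x \<in> M \<Longrightarrow> - x \<in> M" for x
    using d[OF z] by simp
  show "x \<in> M \<Longrightarrow> y \<in> M \<Longrightarrow> x + y \<in> M"
    using d[OF _ m] by fastforce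
qed

lemma add_subgroup_scale_nat:
  fixes M :: "'a::real_vector set"
  assumes "add_subgroup M" "x \<in> M"
  shows "real k *\<^sub>R x \<in> M"
  by (induction k) (use assms in \<open>auto simp: add_subgroupD scaleR_left_distrib\<close>)

lemma add_subgroup_scale_int:
  fixes M :: "'a::real_vector set"
  assumes "add_subgroup M" "x \<in> M"
  shows "real_of_int k *\<^sub>R x \<in> M"
proof (cases "k \<ge> 0")
  case True
  then show ?thesis
    using add_subgroup_scale_nat[OF assms, of "nat k"] by simp
next
  case False
  then have "real_of_int k *\<^sub>R x = - (real (nat (- k)) *\<^sub>R x)"
    by simp
  then show ?thesis
    using add_subgroup_scale_nat[OF assms] add_subgroupD(3)[OF assms(1)] by simp
qed

lemma add_subgroup_sum:
  assumes "add_subgroup M" "\<And>i. i \<in> I \<Longrightarrow> f i \<in> M"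
  shows "sum f I \<in> M"
  using assms(2) by (induction I rule: infinite_finite_induct)
    (auto simp: add_subgroupD[OF assms(1)])

lemma full_rank_lattice_subgroup:
  fixes L :: "(real^'n) set"
  assumes "full_rank_lattice L"
  shows "add_subgroup L"
proof -
  obtain B :: "real^'n^'n" where L: "L = (*v) B ` {x. \<forall>i. x $ i \<in> \<int>}"
    using assms by (rule full_rank_lattice_obtain)
  have "B *v x - B *v y \<in> L" if "\<forall>i. x $ i \<in> \<int>" "\<forall>i. y $ i \<in> \<int>" for x y
    unfolding L matrix_vector_mult_diff_distrib[symmetric] using that by auto
  moreover have "B *v 0 \<in> L"
    unfolding L by (intro imageI) auto
  ultimately show ?thesis
    by (auto simp: add_subgroup_def L)
qed

lemma lattice_basis_columns:
  assumes "lattice_basis B L"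
  shows "column j B \<in> L"
proof -
  have "B *v axis j 1 \<in> L"
    using assms by (auto simp: lattice_basis_iff axis_def intro!: imageI)
  then show ?thesis
    by (simp add: matrix_vector_mult_basis)
qed

text \<open>Integral coordinates of the columns give \<open>C = B ** U\<close> with an integral
  matrix \<open>U\<close>, whose determinant is an integer.\<close>

lemma det_lattice_vectors:
  assumes B: "lattice_basis B L" and C: "\<And>j. column j C \<in> L"
  shows "\<exists>k::int. det C = real_of_int k * det B"
proof -
  have "\<exists>x. column j C = B *v x \<and> (\<forall>i. x $ i \<in> \<int>)" for j
    using B C[of j] by (auto simp: lattice_basis_iff)
  then obtain x where x: "\<And>j. column j C = B *v x j" "\<And>i j. x j $ i \<in> \<int>"
    by metis
  define U :: "real^'a^'a" where "U = (\<chi> i j. x j $ i)"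
  have "C $ i $ j = (B ** U) $ i $ j" for i j
    using arg_cong[OF x(1)[of j], of "\<lambda>v. v $ i"]
    by (simp add: column_def matrix_vector_mult_def matrix_matrix_mult_def U_def)
  then have "C = B ** U"
    by (simp add: vec_eq_iff)
  then have "det C = det U * det B"
    by (simp add: det_mul)
  moreover have "det U \<in> \<int>"
    unfolding det_def U_def by (intro Ints_sum Ints_mult Ints_prod) (auto simp: x)
  ultimately show ?thesis
    by (metis Ints_cases)
qed

lemma column_replace:
  "column j (\<chi> i j. if j = k then v $ i else C $ i $ j) = (if j = k then v else column j C)"
  by (simp add: column_def vec_eq_iff)

lemma matrix_vector_solvable:
  fixes C :: "real^'n^'n"
  assumes "det C \<noteq> 0"
  shows "\<exists>y. C *v y = x"
  using cramer[OF assms] by blast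

text \<open>By Cramer's rule, the coordinates of \<open>x\<close> in the basis \<open>C\<close> of
  \<open>M\<close> are quotients of determinants of vectors of \<open>L\<close>. All of these are
  integer multiples of \<open>det B\<close>, so \<open>k = det C / det B\<close> clears the
  denominators.\<close>

lemma sublattice_multiple:
  fixes L M :: "(real^'n) set"
  assumes L: "full_rank_lattice L" and M: "full_rank_lattice M" and sub: "M \<subseteq> L"
  shows "\<exists>N::nat. 0 < N \<and> (\<forall>x\<in>L. real N *\<^sub>R x \<in> M)"
proof -
  obtain B C where B: "lattice_basis B L" and C: "lattice_basis C M"
    using L M by (auto simp: full_rank_lattice_def)
  have colC: "column j C \<in> L" for j
    using lattice_basis_columns[OF C] sub by auto
  then obtain k :: int where k: "det C = real_of_int k * det B"
    using det_lattice_vectors[OF B] by blast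
  have nz: "det B \<noteq> 0" "det C \<noteq> 0"
    using B C by (auto simp: lattice_basis_def invertible_det_nz)
  then have k0: "k \<noteq> 0"
    using k by auto
  have "real_of_int k *\<^sub>R x \<in> M" if x: "x \<in> L" for x
  proof -
    obtain y where y: "C *v y = x"
      using matrix_vector_solvable[OF nz(2)] by blast
    have "real_of_int k * y $ j \<in> \<int>" for j
    proof -
      have "\<exists>l::int. det (\<chi> i j'. if j' = j then x $ i else C $ i $ j') = real_of_int l * det B"
        by (rule det_lattice_vectors[OF B]) (simp add: column_replace colC x)
      then obtain l :: int where "y $ j * det C = real_of_int l * det B"
        using cramer_lemma[of j C y] y by metis
      then have "real_of_int k * y $ j = real_of_int l"
        using nz by (simp add: k mult.commute)
      then show ?thesis
        by simp
    qed
    moreover have "real_of_int k *\<^sub>R x = C *v (real_of_int k *\<^sub>R y)"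
      by (simp add: y matrix_vector_mult_scaleR)
    ultimately show ?thesis
      using C by (auto simp: lattice_basis_iff)
  qed
  then have "real (nat \<bar>k\<bar>) *\<^sub>R x \<in> M" if "x \<in> L" for x
    using that add_subgroupD(3)[OF full_rank_lattice_subgroup[OF M]]
    by (fastforce simp: abs_if)
  then show ?thesis
    using k0 by (intro exI[of _ "nat \<bar>k\<bar>"]) auto
qed

text \<open>Multiply the individual multipliers. This puts a multiple of \<Omega> inside the
  intersection of the sublattices, which then has full rank and finite index.\<close>

lemma common_multiple:
  fixes L :: "'a::real_vector set"
  assumes "finite I"
    and "\<And>i. i \<in> I \<Longrightarrow> add_subgroup (M i)"
    and "\<And>i. i \<in> I \<Longrightarrow> \<exists>N::nat. 0 < N \<and> (\<forall>x\<in>L. real N *\<^sub>R x \<in> M i)"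
  shows "\<exists>N::nat. 0 < N \<and> (\<forall>i\<in>I. \<forall>x\<in>L. real N *\<^sub>R x \<in> M i)"
  using assms
proof (induction I rule: finite_induct)
  case empty
  then show ?case by auto
next
  case (insert i I)
  obtain N :: nat where N: "0 < N" "\<forall>i\<in>I. \<forall>x\<in>L. real N *\<^sub>R x \<in> M i"
    using insert by auto
  obtain K :: nat where K: "0 < K" "\<forall>x\<in>L. real K *\<^sub>R x \<in> M i"
    using insert.prems(2)[of i] by auto
  have "real (N * K) *\<^sub>R x \<in> M j" if "j \<in> insert i I" "x \<in> L" for j x
  proof (cases "j = i")
    case True
    then show ?thesis
      using add_subgroup_scale_nat[of "M i" "real K *\<^sub>R x" N] K that insert.prems by simp
  next
    case False
    then show ?thesis
      using add_subgroup_scale_nat[of "M j" "real N *\<^sub>R x" K] N that insert.prems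
      by (simp add: mult.commute)
  qed
  then show ?case
    using N K by (intro exI[of _ "N * K"]) auto
qed

text \<open>A system of vectors of \<open>M\<close> whose determinant is minimal in absolute value is a basis:
  a point of \<open>M\<close> with a non-integral coordinate could replace a basis vector, after reducing
  that coordinate modulo 1, and make the determinant smaller.\<close>

lemma full_rank_sublattice:
  fixes L M :: "(real^'n) set"
  assumes L: "full_rank_lattice L" and M: "add_subgroup M" and sub: "M \<subseteq> L"
    and N: "0 < N" "\<And>x. x \<in> L \<Longrightarrow> real N *\<^sub>R x \<in> M"
  shows "full_rank_lattice M"
proof -
  obtain B where B: "lattice_basis B L"
    using L by (auto simp: full_rank_lattice_def)
  have B0: "det B \<noteq> 0"
    using B by (auto simp: lattice_basis_def invertible_det_nz)
  define adm where "adm C \<longleftrightarrow> det C \<noteq> 0 \<and> (\<forall>j. column j C \<in> M)" for C :: "real^'n^'n"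
  \<comment> \<open>\<open>det C / det B\<close> is an integer for every admissible
    \<open>C\<close>, so its absolute value is a natural number and attains a minimum.\<close>
  define f where "f C = nat \<lfloor>\<bar>det C / det B\<bar>\<rfloor>" for C :: "real^'n^'n"
  have f: "\<bar>det C\<bar> = real (f C) * \<bar>det B\<bar>" if C: "adm C" for C
  proof -
    have "column j C \<in> L" for j
      using C sub by (auto simp: adm_def)
    then obtain k :: int where k: "det C = real_of_int k * det B"
      using det_lattice_vectors[OF B] by blast
    then have "\<bar>det C / det B\<bar> = real_of_int \<bar>k\<bar>"
      using B0 by (simp add: abs_mult)
    then have "f C = nat \<bar>k\<bar>"
      unfolding f_def by (metis floor_of_int)
    then show ?thesis
      by (simp add: k abs_mult)
  qed
  \<comment> \<open>\<open>N\<close> times a basis of \<open>L\<close> is an admissible system, so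
    there is one to minimise over.\<close>
  have "column j (B ** mat (real N)) = real N *\<^sub>R column j B" for j
    by (simp add: column_def vec_eq_iff matrix_matrix_mult_def mat_def if_distrib mult.commute
        cong: if_cong)
  moreover have "det (B ** mat (real N)) \<noteq> 0"
    using B0 N(1) by (simp add: det_mul det_diagonal mat_def)
  ultimately have "adm (B ** mat (real N))"
    using N(2)[OF lattice_basis_columns[OF B]] by (auto simp: adm_def)
  then obtain C where C: "adm C" and min: "\<And>C'. adm C' \<Longrightarrow> f C \<le> f C'"
    using ex_has_least_nat[of adm _ f] by blast
  have C0: "det C \<noteq> 0"
    using C by (simp add: adm_def)
  have "\<exists>y. C *v y = x \<and> (\<forall>j. y $ j \<in> \<int>)" if x: "x \<in> M" for x
  proof -
    obtain y where y: "C *v y = x"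
      using matrix_vector_solvable[OF C0] by blast
    have "y $ j \<in> \<int>" for j
    proof (rule ccontr)
      assume nint: "y $ j \<notin> \<int>"
      define r where "r = frac (y $ j)"
      have r: "0 < r" "r < 1"
        using nint by (auto simp: r_def frac_lt_1)
      define y' where "y' = y - real_of_int \<lfloor>y $ j\<rfloor> *\<^sub>R axis j 1"
      define C' where "C' = (\<chi> i j'. if j' = j then (C *v y') $ i else C $ i $ j')"
      have "C *v y' = x - real_of_int \<lfloor>y $ j\<rfloor> *\<^sub>R column j C"
        by (simp add: y'_def y matrix_vector_mult_diff_distrib matrix_vector_mult_scaleR
            matrix_vector_mult_basis)
      then have "C *v y' \<in> M"
        using x C add_subgroup_scale_int[OF M] add_subgroupD(2)[OF M] by (simp add: adm_def)
      \<comment> \<open>By Cramer's rule the replacement scales the determinant by the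
        \<open>j\<close>-th coordinate of \<open>y'\<close>, which is the fractional part
        \<open>r\<close>.\<close>
      moreover have detC': "det C' = r * det C"
        unfolding C'_def by (simp add: cramer_lemma y'_def r_def frac_def axis_def)
      ultimately have "adm C'"
        using C r unfolding adm_def C'_def by (simp add: column_replace)
      then have "real (f C) * \<bar>det B\<bar> \<le> real (f C') * \<bar>det B\<bar>" "\<bar>det C'\<bar> = real (f C') * \<bar>det B\<bar>"
        using min f by (auto intro!: mult_right_mono)
      then have "\<bar>det C\<bar> \<le> r * \<bar>det C\<bar>"
        using f[OF C] unfolding detC' abs_mult using r by linarith
      then show False
        using C0 r by simp
    qed
    then show ?thesis
      using y by blast
  qed
  moreover have "C *v y \<in> M" if y: "\<forall>j. y $ j \<in> \<int>" for y
  proof -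
    have "y $ j *\<^sub>R column j C \<in> M" for j
    proof -
      obtain k :: int where "y $ j = real_of_int k"
        using y Ints_cases[of "y $ j"] by blast
      then show ?thesis
        using C add_subgroup_scale_int[OF M] by (simp add: adm_def)
    qed
    then show ?thesis
      unfolding matrix_mult_sum scalar_mult_eq_scaleR by (intro add_subgroup_sum[OF M])
  qed
  ultimately have "M = (*v) C ` {y. \<forall>j. y $ j \<in> \<int>}"
    by blast
  then have "lattice_basis C M"
    using C0 by (simp add: lattice_basis_iff invertible_det_nz)
  then show ?thesis
    by (auto simp: full_rank_lattice_def)
qed

section \<open>Cosets of a sublattice and its index\<close>

lemma finite_int_vectors: "finite {x::real^'n. \<forall>i. x $ i \<in> \<int> \<and> \<bar>x $ i\<bar> \<le> K}"
proof -
  have "finite {x::real. x \<in> \<int> \<and> \<bar>x\<bar> \<le> K}"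
    by (rule finite_abs_int_segment)
  then have "finite (PiE (UNIV::'n set) (\<lambda>_. {x. x \<in> \<int> \<and> \<bar>x\<bar> \<le> K}))"
    by (intro finite_PiE) auto
  then have "finite (vec_lambda ` (PiE (UNIV::'n set) (\<lambda>_. {x. x \<in> \<int> \<and> \<bar>x\<bar> \<le> K})))"
    by (rule finite_imageI)
  moreover have "{x::real^'n. \<forall>i. x $ i \<in> \<int> \<and> \<bar>x $ i\<bar> \<le> K}
      \<subseteq> vec_lambda ` (PiE (UNIV::'n set) (\<lambda>_. {x. x \<in> \<int> \<and> \<bar>x\<bar> \<le> K}))"
  proof
    fix x :: "real^'n" assume "x \<in> {x. \<forall>i. x $ i \<in> \<int> \<and> \<bar>x $ i\<bar> \<le> K}"
    then show "x \<in> vec_lambda ` (PiE (UNIV::'n set) (\<lambda>_. {x. x \<in> \<int> \<and> \<bar>x\<bar> \<le> K}))"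
      by (intro image_eqI[of _ _ "vec_nth x"]) auto
  qed
  ultimately show ?thesis
    by (rule rev_finite_subset)
qed

lemma coset_eq_iff:
  assumes "add_subgroup M"
  shows "(+) x ` M = (+) y ` M \<longleftrightarrow> x - y \<in> M"
proof
  assume "(+) x ` M = (+) y ` M"
  then have "x \<in> (+) y ` M"
    using add_subgroupD(1)[OF assms] by (metis add.right_neutral image_eqI)
  then show "x - y \<in> M"
    by auto
next
  assume *: "x - y \<in> M"
  have "(+) x ` M \<subseteq> (+) y ` M" if "x - y \<in> M" for x y
  proof
    fix z assume "z \<in> (+) x ` M"
    then obtain u where "u \<in> M" "z = x + u" by auto
    then have "z = y + ((x - y) + u)" "(x - y) + u \<in> M"
      using that add_subgroupD(4)[OF assms] by auto
    then show "z \<in> (+) y ` M" by blast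
  qed
  moreover have "y - x \<in> M"
    using add_subgroupD(3)[OF assms *] by simp
  ultimately show "(+) x ` M = (+) y ` M"
    using * by blast
qed

text \<open>Since \<open>N\<close> times \<open>L\<close> lies in \<open>M\<close>, reducing the
  integral coordinates modulo \<open>N\<close> does not change the coset. Finitely many residue
  vectors remain.\<close>

lemma finite_cosets:
  fixes L M :: "(real^'n) set"
  assumes L: "full_rank_lattice L" and M: "add_subgroup M"
    and N: "0 < N" "\<And>x. x \<in> L \<Longrightarrow> real N *\<^sub>R x \<in> M"
  shows "finite ((\<lambda>x. (+) x ` M) ` L)"
proof -
  obtain B :: "real^'n^'n" where B: "L = (*v) B ` {x. \<forall>i. x $ i \<in> \<int>}"
    using L by (rule full_rank_lattice_obtain)
  let ?F = "{x::real^'n. \<forall>i. x $ i \<in> \<int> \<and> \<bar>x $ i\<bar> \<le> real N}"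
  have "(\<lambda>x. (+) x ` M) ` L \<subseteq> (\<lambda>c. (+) (B *v c) ` M) ` ?F"
  proof (rule image_subsetI)
    fix x assume "x \<in> L"
    then obtain c where c: "x = B *v c" "\<forall>i. c $ i \<in> \<int>"
      using B by auto
    define q :: "real^'n" where "q = (\<chi> i. real_of_int (\<lfloor>c $ i\<rfloor> div int N))"
    define r :: "real^'n" where "r = (\<chi> i. real_of_int (\<lfloor>c $ i\<rfloor> mod int N))"
    have "c $ i = real N * q $ i + r $ i" for i
    proof -
      have "c $ i = real_of_int (int N * (\<lfloor>c $ i\<rfloor> div int N) + \<lfloor>c $ i\<rfloor> mod int N)"
        using c by simp
      then show ?thesis
        unfolding q_def r_def of_int_add of_int_mult by simp
    qed
    then have "c - r = real N *\<^sub>R q"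
      by (simp add: vec_eq_iff)
    then have "x - B *v r = real N *\<^sub>R (B *v q)"
      by (simp add: c matrix_vector_mult_diff_distrib[symmetric] matrix_vector_mult_scaleR)
    moreover have "B *v q \<in> L"
      unfolding B by (intro imageI) (auto simp: q_def)
    ultimately have "(+) x ` M = (+) (B *v r) ` M"
      using N(2) by (simp add: coset_eq_iff[OF M])
    moreover have "real_of_int (\<lfloor>c $ i\<rfloor> mod int N) \<le> real N" for i
      using pos_mod_bound[of "int N" "\<lfloor>c $ i\<rfloor>"] N(1) by linarith
    then have "r \<in> ?F"
      using N(1) by (auto simp: r_def)
    ultimately show "(+) x ` M \<in> (\<lambda>c. (+) (B *v c) ` M) ` ?F"
      by blast
  qed
  then show ?thesis
    using finite_int_vectors by (rule finite_subset[OF _ finite_imageI])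
qed

text \<open>Adding \<open>M'\<close> realises the canonical map from cosets of \<open>M\<close> to
  cosets of \<open>M'\<close> without choosing representatives.\<close>

lemma coset_map:
  assumes "add_subgroup M'" "M \<subseteq> M'" "0 \<in> M"
  shows "{u + v | u v. u \<in> (+) x ` M \<and> v \<in> M'} = (+) x ` M'"
proof (intro equalityI subsetI)
  fix z assume "z \<in> {u + v | u v. u \<in> (+) x ` M \<and> v \<in> M'}"
  then obtain m v where "z = x + (m + v)" "m \<in> M" "v \<in> M'"
    by (auto simp: add.assoc)
  then show "z \<in> (+) x ` M'"
    using assms add_subgroupD(4)[OF assms(1)] by blast
next
  fix z assume "z \<in> (+) x ` M'"
  then show "z \<in> {u + v | u v. u \<in> (+) x ` M \<and> v \<in> M'}"
    using assms(3) by force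
qed

text \<open>The canonical map between the quotients is onto. Finiteness matters because an infinite
  quotient by \<open>M\<close> would have index 0.\<close>

lemma lattice_index_antimono:
  assumes "add_subgroup M'" "M \<subseteq> M'" "0 \<in> M" "finite ((\<lambda>x. (+) x ` M) ` L)"
  shows "lattice_index L M' \<le> lattice_index L M"
  unfolding lattice_index_def
proof (rule surj_card_le[OF assms(4)])
  show "(\<lambda>x. (+) x ` M') ` L \<subseteq> (\<lambda>S. {u + v | u v. u \<in> S \<and> v \<in> M'}) ` (\<lambda>x. (+) x ` M) ` L"
    unfolding image_image coset_map[OF assms(1-3)] by simp
qed

text \<open>A coset of the intersection is determined by the cosets of all \<open>M i\<close>
  containing it, so the quotient embeds into the product of the quotients.\<close>

lemma lattice_index_Inter:
  assumes I: "finite I" and M: "\<And>i. i \<in> I \<Longrightarrow> add_subgroup (M i)"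
    and fin: "\<And>i. i \<in> I \<Longrightarrow> finite ((\<lambda>x. (+) x ` M i) ` L)"
  shows "lattice_index L (\<Inter>i\<in>I. M i) \<le> (\<Prod>i\<in>I. lattice_index L (M i))"
proof -
  let ?K = "\<Inter>i\<in>I. M i"
  have K: "add_subgroup ?K"
    using M by (auto simp: add_subgroup_def)
  define g where "g S = (\<lambda>i\<in>I. {u + v | u v. u \<in> S \<and> v \<in> M i})" for S
  have g: "g ((+) x ` ?K) = (\<lambda>i\<in>I. (+) x ` M i)" for x
    unfolding g_def using M add_subgroupD(1)[OF K]
    by (intro restrict_ext coset_map) auto
  have "inj_on g ((\<lambda>x. (+) x ` ?K) ` L)"
  proof (rule inj_onI, clarify)
    fix x y assume "g ((+) x ` ?K) = g ((+) y ` ?K)"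
    then have "(+) x ` M i = (+) y ` M i" if "i \<in> I" for i
      using that unfolding g by (metis restrict_apply')
    then have "x - y \<in> ?K"
      using coset_eq_iff[OF M] by blast
    then show "(+) x ` ?K = (+) y ` ?K"
      by (simp add: coset_eq_iff[OF K])
  qed
  moreover have "g ` (\<lambda>x. (+) x ` ?K) ` L \<subseteq> (\<Pi>\<^sub>E i\<in>I. (\<lambda>x. (+) x ` M i) ` L)"
    unfolding image_image g by auto
  moreover have "finite (\<Pi>\<^sub>E i\<in>I. (\<lambda>x. (+) x ` M i) ` L)"
    using I fin by (rule finite_PiE)
  ultimately have "card ((\<lambda>x. (+) x ` ?K) ` L) \<le> card (\<Pi>\<^sub>E i\<in>I. (\<lambda>x. (+) x ` M i) ` L)"
    by (rule card_inj_on_le)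
  then show ?thesis
    by (simp add: lattice_index_def card_PiE I)
qed


section \<open>Successive minima and covering radius\<close>

text \<open>The inverse matrix is bounded, so lattice points in a cube have bounded integral
  coordinates.\<close>

lemma finite_lattice_cube:
  fixes L :: "(real^'n) set"
  assumes "full_rank_lattice L"
  shows "finite (cube T \<inter> L)"
proof -
  obtain B :: "real^'n^'n" where B: "det B \<noteq> 0" "L = (*v) B ` {x. \<forall>i. x $ i \<in> \<int>}"
    using assms by (rule full_rank_lattice_obtain)
  obtain C where C: "C ** B = mat 1"
    using B(1) by (metis invertible_det_nz invertible_def)
  obtain K where K: "K > 0" "\<And>x. norm (C *v x) \<le> norm x * K"
    using bounded_linear.pos_bounded[OF matrix_vector_mul_bounded_linear[of C]] by blast
  let ?R = "sqrt DIM(real^'n) * T * K"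
  have "cube T \<inter> L \<subseteq> (*v) B ` {x. \<forall>i. x $ i \<in> \<int> \<and> \<bar>x $ i\<bar> \<le> ?R}"
  proof
    fix x assume x: "x \<in> cube T \<inter> L"
    then obtain c where c: "x = B *v c" "\<forall>i. c $ i \<in> \<int>"
      using B by auto
    have "C *v x = c"
      by (simp add: c matrix_vector_mul_assoc C)
    moreover have "norm x \<le> sqrt DIM(real^'n) * T"
      using x norm_le_infnorm[of x]
      by (auto simp: cube_def intro: order_trans[OF _ mult_left_mono])
    ultimately have "norm c \<le> ?R"
      using K(2)[of x] K(1) by (meson mult_right_mono less_imp_le order_trans)
    then have "\<bar>c $ i\<bar> \<le> ?R" for i
      using component_le_norm_cart[of c i] by linarith
    then show "x \<in> (*v) B ` {x. \<forall>i. x $ i \<in> \<int> \<and> \<bar>x $ i\<bar> \<le> ?R}"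
      using c by blast
  qed
  then show ?thesis
    using finite_int_vectors by (rule finite_subset[OF _ finite_imageI])
qed

section \<open>The covering radius as the supremum of the distances to the lattice\<close>

lemma closed_lattice:
  fixes L :: "(real^'n) set"
  assumes "full_rank_lattice L"
  shows "closed L"
proof -
  obtain B :: "real^'n^'n" where B: "det B \<noteq> 0" "L = (*v) B ` {x. \<forall>i. x $ i \<in> \<int>}"
    using assms by (rule full_rank_lattice_obtain)
  have "closed {x::real^'n. \<forall>i. x $ i \<in> \<int>}"
  proof (rule closed_Collect_all)
    fix i :: 'n
    have "closed ((\<lambda>x::real^'n. x $ i) -` \<int>)"
      by (intro closed_vimage closed_Ints continuous_intros)
    then show "closed {x::real^'n. x $ i \<in> \<int>}"
      by (simp add: vimage_def)
  qed
  then show ?thesis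
    unfolding B(2) using B(1)
    by (intro closed_injective_linear_image) (auto simp: inj_matrix_vector_mult invertible_det_nz)
qed

text \<open>The minimum defining the covering radius has to be shown to exist before its sign can be
  read off: it is the supremum of the distances to \<open>L\<close>, which is finite and
  positive.\<close>

lemma covering_radius_pos:
  fixes L :: "(real^'n) set"
  assumes L: "full_rank_lattice L"
  shows "0 < covering_radius L"
proof -
  obtain B :: "real^'n^'n" where B: "det B \<noteq> 0" "L = (*v) B ` {x. \<forall>i. x $ i \<in> \<int>}"
    using L by (rule full_rank_lattice_obtain)
  have inj: "inj ((*v) B)"
    using B(1) by (simp add: inj_matrix_vector_mult invertible_det_nz)
  have ne: "L \<noteq> {}"
    using add_subgroupD(1)[OF full_rank_lattice_subgroup[OF L]] by auto
  define covers where "covers T \<longleftrightarrow> {b + l | b l. b \<in> cball 0 T \<and> l \<in> L} = UNIV" for T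
  \<comment> \<open>Closedness of \<open>L\<close> gives a nearest lattice point, so covering with
    radius \<open>T\<close> means that no distance to \<open>L\<close> exceeds
    \<open>T\<close>.\<close>
  have covers: "covers T \<longleftrightarrow> (\<forall>x. infdist x L \<le> T)" for T
  proof
    assume T: "covers T"
    show "\<forall>x. infdist x L \<le> T"
    proof
      fix x
      obtain b l where "x = b + l" "b \<in> cball 0 T" "l \<in> L"
        using T unfolding covers_def by blast
      then show "infdist x L \<le> T"
        using infdist_le[of l L x] by (simp add: dist_norm)
    qed
  next
    assume T: "\<forall>x. infdist x L \<le> T"
    have "\<exists>b l. x = b + l \<and> b \<in> cball 0 T \<and> l \<in> L" for x
    proof -
      obtain l where "l \<in> L" "infdist x L = dist x l"
        using infdist_attains_inf[OF closed_lattice[OF L] ne] by blast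
      then have "x = (x - l) + l" "x - l \<in> cball 0 T" "l \<in> L"
        using T[rule_format, of x] by (auto simp: dist_norm norm_minus_commute)
      then show ?thesis by blast
    qed
    then show "covers T"
      unfolding covers_def by blast
  qed
  obtain K where K: "K > 0" "\<And>x. norm (B *v x) \<le> norm x * K"
    using bounded_linear.pos_bounded[OF matrix_vector_mul_bounded_linear[of B]] by blast
  \<comment> \<open>Rounding all coordinates down moves the coordinate vector by at most
    \<open>CARD('n)\<close> in norm, and \<open>B\<close> enlarges this by at most the factor
    \<open>K\<close>.\<close>
  have "infdist x L \<le> real CARD('n) * K" for x
  proof -
    obtain y where y: "B *v y = x"
      using matrix_vector_solvable[OF B(1)] by blast
    define q :: "real^'n" where "q = (\<chi> i. real_of_int \<lfloor>y $ i\<rfloor>)"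
    have "norm (y - q) \<le> (\<Sum>i\<in>UNIV. \<bar>(y - q) $ i\<bar>)"
      by (rule norm_le_l1_cart)
    also have "\<dots> \<le> (\<Sum>i\<in>(UNIV::'n set). 1)"
      by (intro sum_mono) (simp add: q_def, linarith)
    finally have "norm (B *v (y - q)) \<le> real CARD('n) * K"
      using K(2)[of "y - q"] K(1) by (simp add: mult_right_mono order_trans)
    moreover have "B *v q \<in> L"
      unfolding B(2) by (intro imageI) (auto simp: q_def)
    ultimately show ?thesis
      using infdist_le[of "B *v q" L x]
      by (simp add: y matrix_vector_mult_diff_distrib dist_norm)
  qed
  then have bdd: "bdd_above (range (\<lambda>x. infdist x L))"
    by (auto simp: bdd_above_def)
  \<comment> \<open>Half of a basis vector, at an arbitrary index, is not a lattice point and thus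
    at positive distance from the closed set \<open>L\<close>.\<close>
  let ?x = "B *v axis undefined (1/2)"
  have "?x \<notin> L"
  proof
    assume "?x \<in> L"
    then have "axis undefined (1/2) \<in> {x::real^'n. \<forall>i. x $ i \<in> \<int>}"
      using inj unfolding B(2) by (meson inj_image_mem_iff)
    then have "(1/2::real) \<in> \<int>"
      by (auto simp: axis_def split: if_splits)
    then obtain k :: int where "1/2 = real_of_int k"
      by (rule Ints_cases)
    then have "real_of_int (2 * k) = real_of_int 1"
      by simp
    then have "2 * k = 1"
      unfolding of_int_eq_iff .
    then show False
      by presburger
  qed
  then have "0 < infdist ?x L"
    using infdist_pos_not_in_closed[OF closed_lattice[OF L] ne] by blast
  also have "\<dots> \<le> (SUP x. infdist x L)"
    using bdd by (rule cSUP_upper[OF UNIV_I])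
  finally have pos: "0 < (SUP x. infdist x L)" .
  have "covering_radius L = (SUP x. infdist x L)"
    unfolding covering_radius_def covers_def[symmetric] covers
  proof (rule Least_equality)
    show "0 < (SUP x. infdist x L) \<and> (\<forall>x. infdist x L \<le> (SUP x. infdist x L))"
      using pos bdd by (auto intro: cSUP_upper)
    show "(SUP x. infdist x L) \<le> T" if "0 < T \<and> (\<forall>x. infdist x L \<le> T)" for T
      using that by (intro cSUP_least) auto
  qed
  then show ?thesis
    using pos by simp
qed

text \<open>The span can change only when \<open>T\<close> reaches the norm of a lattice point. Up
  to a fixed \<open>T0\<close> there are finitely many such norms, so the minimum exists and is
  attained.\<close>

lemma successive_min_attained:
  fixes L :: "(real^'n) set"
  assumes L: "full_rank_lattice L" and i: "1 \<le> i" "i \<le> CARD('n)"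
  shows "0 < successive_min L i \<and> i \<le> dim (span (cube (successive_min L i) \<inter> L))"
proof -
  obtain B where B: "lattice_basis B L"
    using L by (auto simp: full_rank_lattice_def)
  define A where "A = {T. 0 < T \<and> i \<le> dim (span (cube T \<inter> L))}"
  \<comment> \<open>The cube of this size contains a whole basis; the summand 1 makes it
    positive.\<close>
  define T0 where "T0 = 1 + (\<Sum>j\<in>UNIV. infnorm (column j B))"
  have T0: "T0 \<in> A"
  proof -
    have col: "column j B \<in> cube T0 \<inter> L" for j
    proof -
      have "infnorm (column j B) \<le> (\<Sum>j\<in>UNIV. infnorm (column j B))"
        by (rule member_le_sum) (auto simp: infnorm_pos_le)
      then show ?thesis
        using lattice_basis_columns[OF B] by (simp add: cube_def T0_def)
    qed
    have "x \<in> span (cube T0 \<inter> L)" for x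
    proof -
      have "det B \<noteq> 0"
        using B by (simp add: lattice_basis_def invertible_det_nz)
      then obtain y where "B *v y = x"
        using matrix_vector_solvable by blast
      then have "x = (\<Sum>j\<in>UNIV. y $ j *\<^sub>R column j B)"
        by (simp add: matrix_mult_sum scalar_mult_eq_scaleR)
      also have "\<dots> \<in> span (cube T0 \<inter> L)"
        by (intro span_sum span_scale span_base col)
      finally show ?thesis .
    qed
    then have "span (cube T0 \<inter> L) = UNIV"
      by auto
    moreover have "0 < T0"
      by (auto simp: T0_def infnorm_pos_le intro!: add_pos_nonneg sum_nonneg)
    ultimately show ?thesis
      using i by (simp add: A_def del: dim_span)
  qed
  have zero: "0 \<in> L"
    using add_subgroupD(1)[OF full_rank_lattice_subgroup[OF L]] .
  let ?F = "A \<inter> infnorm ` (cube T0 \<inter> L)"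
  have finF: "finite ?F"
    using finite_lattice_cube[OF L] by auto
  \<comment> \<open>Shrinking \<open>T\<close> to the largest norm of a lattice point in the cube
    keeps all these points, so the span does not get smaller.\<close>
  have step: "\<exists>T'\<in>?F. T' \<le> T" if T: "T \<in> A" "T \<le> T0" for T
  proof -
    let ?S = "infnorm ` (cube T \<inter> L)"
    have S: "finite ?S" "?S \<noteq> {}"
      using finite_lattice_cube[OF L] zero T
      by (auto simp: cube_def infnorm_0 A_def disjoint_iff intro!: exI[of _ 0])
    have sub: "cube T \<inter> L \<subseteq> cube (Max ?S) \<inter> L"
      using S by (auto simp: cube_def)
    have "Max ?S \<in> ?S"
      using S by (rule Max_in)
    then have le: "Max ?S \<le> T" and mem: "Max ?S \<in> infnorm ` (cube T0 \<inter> L)"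
      using T(2) by (auto simp: cube_def)
    \<comment> \<open>Otherwise the cube would contain only the zero vector of \<open>L\<close>,
      contradicting \<open>1 \<le> i\<close>.\<close>
    have "0 < Max ?S"
    proof (rule ccontr)
      assume "\<not> 0 < Max ?S"
      have "x = 0" if "x \<in> cube T \<inter> L" for x
      proof -
        have "infnorm x \<le> Max ?S"
          using sub that by (auto simp: cube_def)
        then show ?thesis
          using \<open>\<not> 0 < Max ?S\<close> infnorm_pos_lt[of x] by linarith
      qed
      then have "cube T \<inter> L \<subseteq> {0}"
        by blast
      then have "dim (span (cube T \<inter> L)) = 0"
        by simp
      then show False
        using T(1) i(1) unfolding A_def mem_Collect_eq by linarith
    qed
    moreover have "dim (span (cube T \<inter> L)) \<le> dim (span (cube (Max ?S) \<inter> L))"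
      using sub by (intro dim_subset span_mono)
    ultimately have "Max ?S \<in> A"
      using T(1) by (simp add: A_def)
    then show ?thesis
      using le mem by blast
  qed
  have neF: "?F \<noteq> {}"
    using step[OF T0] by auto
  have MinA: "Min ?F \<in> ?F"
    using finF neF by (rule Min_in)
  have "successive_min L i = Min ?F"
    unfolding successive_min_def
  proof (rule Least_equality)
    show "0 < Min ?F \<and> i \<le> dim (span (cube (Min ?F) \<inter> L))"
      using MinA by (auto simp: A_def)
    fix T assume "0 < T \<and> i \<le> dim (span (cube T \<inter> L))"
    then have T: "T \<in> A"
      by (simp add: A_def)
    have "Min ?F \<le> T0"
      using MinA by (auto simp: cube_def)
    then show "Min ?F \<le> T"
      using step[OF T] Min_le[OF finF] by (meson linear order_trans)
  qed
  then show ?thesis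
    using MinA by (auto simp: A_def)
qed

text \<open>Greedy choice: the lattice points in the cube of size
  \<open>successive_min L (Suc k)\<close> span dimension at least \<open>k + 1\<close>, so one of
  them lies outside the span of the \<open>k\<close> vectors already chosen.\<close>

lemma independent_lattice_vectors:
  fixes L :: "(real^'n) set"
  assumes L: "full_rank_lattice L" and "k \<le> CARD('n)"
  shows "\<exists>W\<subseteq>L. finite W \<and> independent W \<and> card W = k \<and>
    (\<Sum>w\<in>W. infnorm w) \<le> (\<Sum>i=1..k. successive_min L i)"
  using assms(2)
proof (induction k)
  case 0
  then show ?case
    by (intro exI[of _ "{}"]) (auto simp: independent_empty)
next
  case (Suc k)
  then obtain W where W: "W \<subseteq> L" "finite W" "independent W" "card W = k"
    "(\<Sum>w\<in>W. infnorm w) \<le> (\<Sum>i=1..k. successive_min L i)"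
    by auto
  let ?T = "successive_min L (Suc k)"
  have "Suc k \<le> dim (span (cube ?T \<inter> L))"
    using successive_min_attained[OF L] Suc.prems by simp
  then have "\<not> cube ?T \<inter> L \<subseteq> span W"
    using dim_le_card[of "cube ?T \<inter> L" W] W by auto
  then obtain v where v: "v \<in> cube ?T" "v \<in> L" "v \<notin> span W"
    by auto
  then have "v \<notin> W"
    using span_base by blast
  then show ?case
    using v W by (intro exI[of _ "insert v W"]) (auto simp: cube_def independent_insert)
qed


section \<open>Polynomials on grids\<close>

text \<open>Substituting an affine function of \<open>t\<close> for each variable does not raise the
  total degree. This reduces vanishing in several variables to polynomials in one variable.\<close>

lemma rpoly_eval_line:
  fixes P :: "('n::finite) rpoly"
  shows "\<exists>p. degree p \<le> rpoly_degree P \<and> (\<forall>t. poly p t = rpoly_eval P (y + t *\<^sub>R w))"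
proof -
  define p where "p = (\<Sum>a\<in>Poly_Mapping.keys P. smult (Poly_Mapping.lookup P a)
    (\<Prod>i\<in>UNIV. [:y $ i, w $ i:] ^ Poly_Mapping.lookup a i))"
  have "degree (smult (Poly_Mapping.lookup P a) (\<Prod>i\<in>UNIV. [:y $ i, w $ i:] ^ Poly_Mapping.lookup a i))
      \<le> rpoly_degree P" if a: "a \<in> Poly_Mapping.keys P" for a
  proof -
    have "degree (\<Prod>i\<in>UNIV. [:y $ i, w $ i:] ^ Poly_Mapping.lookup a i)
        \<le> (\<Sum>i\<in>UNIV. degree ([:y $ i, w $ i:] ^ Poly_Mapping.lookup a i))"
      using degree_prod_sum_le[of UNIV "\<lambda>i. [:y $ i, w $ i:] ^ Poly_Mapping.lookup a i"] by simp
    also have "\<dots> \<le> (\<Sum>i\<in>UNIV. Poly_Mapping.lookup a i)"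
    proof (rule sum_mono)
      fix i
      have "degree ([:y $ i, w $ i:] ^ Poly_Mapping.lookup a i)
          \<le> degree [:y $ i, w $ i:] * Poly_Mapping.lookup a i"
        by (rule degree_power_le)
      also have "\<dots> \<le> 1 * Poly_Mapping.lookup a i"
        by (intro mult_right_mono) auto
      finally show "degree ([:y $ i, w $ i:] ^ Poly_Mapping.lookup a i) \<le> Poly_Mapping.lookup a i"
        by simp
    qed
    also have "\<dots> \<le> rpoly_degree P"
      unfolding rpoly_degree_def using a by (intro Max_ge) auto
    finally show ?thesis
      using degree_smult_le order_trans by blast
  qed
  then have "degree p \<le> rpoly_degree P"
    unfolding p_def by (intro degree_sum_le) auto
  moreover have "poly p t = rpoly_eval P (y + t *\<^sub>R w)" for t
    by (simp add: p_def rpoly_eval_def poly_sum poly_prod)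
  ultimately show ?thesis
    by blast
qed

lemma poly_zero_on_initial_segment:
  fixes p :: "real poly"
  assumes "degree p \<le> m" "\<And>k::nat. k \<le> m \<Longrightarrow> poly p (real k) = 0"
  shows "p = 0"
proof (rule ccontr)
  assume p: "p \<noteq> 0"
  have "card (real ` {..m}) \<le> card {x. poly p x = 0}"
    using assms(2) by (intro card_mono poly_roots_finite p) auto
  also have "\<dots> \<le> degree p"
    by (rule card_poly_roots_bound[OF p])
  finally show False
    using assms(1) by (simp add: card_image)
qed

text \<open>Induction on the directions: on a line in direction \<open>v\<close>, the induction
  hypothesis gives zeros at the parameters \<open>0, ..., m\<close>, one too many for a nonzero
  polynomial of degree at most \<open>m\<close>. The base point \<open>y\<close> is arbitrary
  because it moves along \<open>v\<close>.\<close>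

lemma vanish_on_grid:
  fixes f :: "'a::real_vector \<Rightarrow> real"
  assumes line: "\<And>y w. \<exists>p. degree p \<le> m \<and> (\<forall>t. poly p t = f (y + t *\<^sub>R w))"
    and "finite W"
    and "\<And>a::'a \<Rightarrow> nat. (\<And>w. w \<in> W \<Longrightarrow> a w \<le> m) \<Longrightarrow> f (y + (\<Sum>w\<in>W. real (a w) *\<^sub>R w)) = 0"
  shows "f (y + (\<Sum>w\<in>W. t w *\<^sub>R w)) = 0"
  using assms(2,3)
proof (induction W arbitrary: y rule: finite_induct)
  case empty
  then show ?case
    by auto
next
  case (insert v W)
  obtain p where p: "degree p \<le> m" "\<And>s. poly p s = f ((y + (\<Sum>w\<in>W. t w *\<^sub>R w)) + s *\<^sub>R v)"
    using line by metis
  have "poly p (real k) = 0" if k: "k \<le> m" for k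
  proof -
    have "f ((y + real k *\<^sub>R v) + (\<Sum>w\<in>W. t w *\<^sub>R w)) = 0"
    proof (rule insert.IH)
      fix a :: "'a \<Rightarrow> nat" assume a: "\<And>w. w \<in> W \<Longrightarrow> a w \<le> m"
      have "(\<Sum>w\<in>W. real ((a(v := k)) w) *\<^sub>R w) = (\<Sum>w\<in>W. real (a w) *\<^sub>R w)"
        using insert.hyps by (intro sum.cong) auto
      then have "(\<Sum>w\<in>insert v W. real ((a(v := k)) w) *\<^sub>R w) = real k *\<^sub>R v + (\<Sum>w\<in>W. real (a w) *\<^sub>R w)"
        using insert.hyps by simp
      moreover have "f (y + (\<Sum>w\<in>insert v W. real ((a(v := k)) w) *\<^sub>R w)) = 0"
        using a k by (intro insert.prems) auto
      ultimately show "f ((y + real k *\<^sub>R v) + (\<Sum>w\<in>W. real (a w) *\<^sub>R w)) = 0"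
        by (simp add: add.assoc)
    qed
    then show ?thesis
      by (simp add: p(2) algebra_simps)
  qed
  then have "p = 0"
    by (rule poly_zero_on_initial_segment[OF p(1)])
  then show ?case
    using p(2)[of "t v"] insert.hyps by (simp add: algebra_simps)
qed

section \<open>Only the zero polynomial vanishes everywhere: base-\<open>N\<close> digits and
  Kronecker substitution\<close>

lemma digits_unique:
  fixes a b :: "nat \<Rightarrow> nat"
  assumes "\<And>k. k < n \<Longrightarrow> a k < N \<and> b k < N" "(\<Sum>k<n. a k * N ^ k) = (\<Sum>k<n. b k * N ^ k)" "k < n"
  shows "a k = b k"
  using assms
proof (induction n arbitrary: a b k)
  case 0
  then show ?case by simp
next
  case (Suc n)
  have split: "(\<Sum>k<Suc n. c k * N ^ k) = c 0 + N * (\<Sum>k<n. c (Suc k) * N ^ k)" for c :: "nat \<Rightarrow> nat"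
    by (simp add: sum.lessThan_Suc_shift sum_distrib_left mult_ac del: sum.lessThan_Suc)
  have lt: "a 0 < N" "b 0 < N"
    using Suc.prems(1) by auto
  have eq: "a 0 + N * (\<Sum>k<n. a (Suc k) * N ^ k) = b 0 + N * (\<Sum>k<n. b (Suc k) * N ^ k)"
    using Suc.prems(2) unfolding split .
  \<comment> \<open>The lowest digit is the residue modulo \<open>N\<close>; the remaining digits
    are compared by induction after cancelling \<open>N\<close>.\<close>
  then have 0: "a 0 = b 0"
    using lt by (metis mod_less mod_mult_self2)
  then have "(\<Sum>k<n. a (Suc k) * N ^ k) = (\<Sum>k<n. b (Suc k) * N ^ k)"
    using eq lt by simp
  then have "a (Suc j) = b (Suc j)" if "j < n" for j
    using Suc.IH[of "\<lambda>k. a (Suc k)" "\<lambda>k. b (Suc k)" j] Suc.prems(1) that by simp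
  then show ?case
    using 0 Suc.prems(3) by (cases k) auto
qed

text \<open>Kronecker's substitution of \<open>t ^ N ^ i\<close> for the \<open>i\<close>-th variable, with \<open>N\<close> larger than
  the degree, maps distinct monomials to distinct powers of \<open>t\<close>.\<close>

lemma rpoly_eval_eq_zero_imp:
  fixes P :: "('n::finite) rpoly"
  assumes "\<And>z. rpoly_eval P z = 0"
  shows "P = 0"
proof (rule ccontr)
  assume "P \<noteq> 0"
  then obtain b where b: "b \<in> Poly_Mapping.keys P"
    by (metis all_not_in_conv keys_eq_empty)
  define N where "N = Suc (rpoly_degree P)"
  \<comment> \<open>The variables are indexed by an abstract finite type; \<open>e\<close> numbers
    them to provide the exponents of \<open>N\<close>.\<close>
  obtain e :: "'n \<Rightarrow> nat" where e: "bij_betw e UNIV {..<CARD('n)}"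
    using ex_bij_betw_finite_nat[of "UNIV :: 'n set"] by (auto simp: atLeast0LessThan)
  define wt where "wt a = (\<Sum>i\<in>UNIV. Poly_Mapping.lookup a i * N ^ e i)" for a :: "'n \<Rightarrow>\<^sub>0 nat"
  have lt: "Poly_Mapping.lookup a i < N" if "a \<in> Poly_Mapping.keys P" for a i
  proof -
    have "Poly_Mapping.lookup a i \<le> (\<Sum>i\<in>UNIV. Poly_Mapping.lookup a i)"
      by (rule member_le_sum) auto
    also have "\<dots> \<le> rpoly_degree P"
      unfolding rpoly_degree_def using that by (intro Max_ge) auto
    finally show ?thesis
      by (simp add: N_def)
  qed
  have wt: "wt a = (\<Sum>k<CARD('n). Poly_Mapping.lookup a (inv e k) * N ^ k)" for a
  proof -
    have "(\<Sum>k<CARD('n). Poly_Mapping.lookup a (inv e k) * N ^ k)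
        = (\<Sum>i\<in>UNIV. Poly_Mapping.lookup a (inv e (e i)) * N ^ e i)"
      by (rule sum.reindex_bij_betw[OF e, symmetric])
    then show ?thesis
      using e by (simp add: wt_def bij_betw_def)
  qed
  have inj: "a = b" if a: "a \<in> Poly_Mapping.keys P" and eq: "wt a = wt b" for a
  proof (rule poly_mapping_eqI)
    fix i
    have "Poly_Mapping.lookup a (inv e (e i)) = Poly_Mapping.lookup b (inv e (e i))"
    proof (rule digits_unique[where n = "CARD('n)" and N = N and k = "e i"
        and a = "\<lambda>k. Poly_Mapping.lookup a (inv e k)" and b = "\<lambda>k. Poly_Mapping.lookup b (inv e k)"])
      show "e i < CARD('n)"
        using e by (auto simp: bij_betw_def)
    qed (use lt a b eq[unfolded wt] in auto)
    then show "Poly_Mapping.lookup a i = Poly_Mapping.lookup b i"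
      using e by (simp add: bij_betw_def)
  qed
  define p where "p = (\<Sum>a\<in>Poly_Mapping.keys P. monom (Poly_Mapping.lookup P a) (wt a))"
  have "poly p t = rpoly_eval P (\<chi> i. t ^ N ^ e i)" for t
    by (simp add: p_def rpoly_eval_def poly_sum poly_monom wt_def power_sum power_mult[symmetric] mult.commute)
  then have "p = 0"
    using assms by (metis poly_all_0_iff_0)
  \<comment> \<open>Only \<open>b\<close> contributes to the coefficient of \<open>t ^ wt b\<close>,
    since no other monomial of \<open>P\<close> has the same weight.\<close>
  then have "0 = coeff p (wt b)"
    by simp
  also have "\<dots> = (\<Sum>a\<in>Poly_Mapping.keys P. if a = b then Poly_Mapping.lookup P b else 0)"
    unfolding p_def coeff_sum using inj by (intro sum.cong) auto
  also have "\<dots> = Poly_Mapping.lookup P b"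
    using b by simp
  finally show False
    using b by (simp add: in_keys_iff)
qed


section \<open>Points of a coset in the positive orthant\<close>

lemma infnorm_sum_le: "infnorm (sum f I) \<le> (\<Sum>i\<in>I. infnorm (f i))"
  by (induction I rule: infinite_finite_induct)
    (auto simp: infnorm_0 intro: order_trans[OF infnorm_triangle])

lemma infnorm_le_cart:
  fixes x :: "real^'n"
  assumes "\<And>i. \<bar>x $ i\<bar> \<le> r"
  shows "infnorm x \<le> r"
  unfolding infnorm_cart using assms by (intro cSup_least) auto

text \<open>The points \<open>x + \<Sum>w. (b w + a w) w\<close> with \<open>0 \<le> a w \<le> m\<close> form a grid in the coset \<open>x + L\<close>;
  choosing \<open>b w\<close> by rounding centres it at the point all of whose coordinates are
  \<open>(m + 1) / 2 * S\<close>, so that it lies in the cube of side \<open>(m + 1) * S\<close> in the positive orthant.\<close>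

lemma coset_point_nonvanishing:
  fixes L :: "(real^'n) set" and P :: "'n rpoly"
  assumes L: "full_rank_lattice L" and P: "P \<noteq> 0"
  defines "S \<equiv> (\<Sum>i=1..CARD('n). successive_min L i)"
  shows "\<exists>l\<in>L. rpoly_eval P (x + l) \<noteq> 0 \<and> (\<forall>i. 0 \<le> (x + l) $ i) \<and>
    infnorm (x + l) \<le> (real (rpoly_degree P) + 1) * S"
proof -
  let ?m = "rpoly_degree P"
  obtain W where W: "W \<subseteq> L" "finite W" "independent W" "card W = CARD('n)"
    "(\<Sum>w\<in>W. infnorm w) \<le> S"
    using independent_lattice_vectors[OF L order_refl] unfolding S_def by blast
  have span: "span W = UNIV"
    using W card_eq_dim[of W UNIV] by auto
  have coord: "\<exists>t. v = (\<Sum>w\<in>W. t w *\<^sub>R w)" for v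
    using span_finite[OF W(2)] span by blast
  define r where "r = (real ?m + 1) / 2"
  define c :: "real^'n" where "c = (\<chi> i. r * S)"
  obtain t where t: "c - x = (\<Sum>w\<in>W. t w *\<^sub>R w)"
    using coord by blast
  define b where "b w = \<lceil>t w - r\<rceil>" for w
  define y where "y = x + (\<Sum>w\<in>W. real_of_int (b w) *\<^sub>R w)"
  \<comment> \<open>If all grid values vanished, \<open>P\<close> would vanish at every point,
    because \<open>W\<close> spans the whole space, and hence be zero.\<close>
  have "\<exists>a::real^'n \<Rightarrow> nat. (\<forall>w\<in>W. a w \<le> ?m) \<and>
      rpoly_eval P (y + (\<Sum>w\<in>W. real (a w) *\<^sub>R w)) \<noteq> 0"
  proof (rule ccontr)
    assume neg: "\<not> ?thesis"
    have "rpoly_eval P z = 0" for z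
    proof -
      obtain u where u: "z - y = (\<Sum>w\<in>W. u w *\<^sub>R w)"
        using coord by blast
      have "rpoly_eval P (y + (\<Sum>w\<in>W. u w *\<^sub>R w)) = 0"
      proof (rule vanish_on_grid[OF rpoly_eval_line W(2)])
        fix a :: "real^'n \<Rightarrow> nat" assume "\<And>w. w \<in> W \<Longrightarrow> a w \<le> ?m"
        then show "rpoly_eval P (y + (\<Sum>w\<in>W. real (a w) *\<^sub>R w)) = 0"
          using neg by blast
      qed
      then show ?thesis
        by (simp add: u[symmetric])
    qed
    then show False
      using rpoly_eval_eq_zero_imp P by blast
  qed
  then obtain a :: "real^'n \<Rightarrow> nat" where a: "\<And>w. w \<in> W \<Longrightarrow> a w \<le> ?m"
    "rpoly_eval P (y + (\<Sum>w\<in>W. real (a w) *\<^sub>R w)) \<noteq> 0"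
    by blast
  define l where "l = (\<Sum>w\<in>W. real_of_int (b w + int (a w)) *\<^sub>R w)"
  have xl: "x + l = y + (\<Sum>w\<in>W. real (a w) *\<^sub>R w)"
    by (simp add: l_def y_def scaleR_left_distrib sum.distrib)
  have lL: "l \<in> L"
    unfolding l_def using W(1) full_rank_lattice_subgroup[OF L]
    by (intro add_subgroup_sum add_subgroup_scale_int) auto
  have "x + l - c = l - (c - x)"
    by simp
  also have "\<dots> = (\<Sum>w\<in>W. (real_of_int (b w + int (a w)) - t w) *\<^sub>R w)"
    unfolding t l_def by (simp add: sum_subtractf[symmetric] scaleR_left_diff_distrib)
  also have "infnorm \<dots> \<le> (\<Sum>w\<in>W. infnorm ((real_of_int (b w + int (a w)) - t w) *\<^sub>R w))"
    by (rule infnorm_sum_le)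
  also have "\<dots> \<le> (\<Sum>w\<in>W. r * infnorm w)"
  proof (rule sum_mono)
    fix w assume "w \<in> W"
    then have "real (a w) \<le> real ?m"
      using a by simp
    moreover have "t w - r \<le> real_of_int (b w)" "real_of_int (b w) < t w - r + 1"
      unfolding b_def by linarith+
    moreover have "2 * r = real ?m + 1"
      by (simp add: r_def)
    \<comment> \<open>Rounding places \<open>b w - t w\<close> in \<open>[-r, 1 - r)\<close>, and
      adding \<open>a w\<close> between \<open>0\<close> and \<open>?m\<close> leaves it in
      \<open>[-r, ?m + 1 - r) = [-r, r)\<close>.\<close>
    ultimately have "\<bar>real_of_int (b w + int (a w)) - t w\<bar> \<le> r"
      unfolding abs_le_iff of_int_add of_int_of_nat_eq by linarith
    then show "infnorm ((real_of_int (b w + int (a w)) - t w) *\<^sub>R w) \<le> r * infnorm w"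
      unfolding infnorm_mul by (intro mult_right_mono infnorm_pos_le)
  qed
  also have "\<dots> \<le> r * S"
    unfolding sum_distrib_left[symmetric] using W(5) by (intro mult_left_mono) (auto simp: r_def)
  finally have dist: "infnorm (x + l - c) \<le> r * S" .
  have comp: "0 \<le> (x + l) $ i \<and> (x + l) $ i \<le> 2 * r * S" for i
  proof -
    have "\<bar>(x + l - c) $ i\<bar> \<le> r * S"
      using component_le_infnorm_cart dist by (rule order_trans)
    then show ?thesis
      by (auto simp: c_def abs_le_iff mult_ac)
  qed
  then have "infnorm (x + l) \<le> 2 * r * S"
    by (intro infnorm_le_cart) (metis abs_of_nonneg)
  moreover have "2 * r = real ?m + 1"
    by (simp add: r_def)
  ultimately show ?thesis
    using lL a(2) comp unfolding xl[symmetric] by (intro bexI[of _ l]) auto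
qed

section \<open>Passage to the coset of a point outside all sublattices, and comparison of the
  bounds\<close>

theorem theorem6p1:
  fixes \<Omega> \<Lambda> :: "(real^'n) set" and \<Lambda>s :: "nat \<Rightarrow> (real^'n) set"
    and \<Delta> :: real and s D m :: nat and Ds :: "nat \<Rightarrow> nat"
    and P :: "'n rpoly"
  assumes "full_rank_lattice \<Omega>" and "lattice_det \<Omega> = \<Delta>"
    and "1 \<le> s"
    and "\<And>i. i \<in> {1..s} \<Longrightarrow> full_rank_lattice (\<Lambda>s i)"
    and "\<And>i. i \<in> {1..s} \<Longrightarrow> \<Lambda>s i \<subseteq> \<Omega>"
    and "\<And>i. i \<in> {1..s} \<Longrightarrow> lattice_index \<Omega> (\<Lambda>s i) = Ds i"
    and "\<Lambda> = (\<Inter>i\<in>{1..s}. \<Lambda>s i)"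
    and "lattice_index \<Omega> \<Lambda> = D"
    and "\<not> \<Omega> \<subseteq> (\<Union>i\<in>{1..s}. \<Lambda>s i)"
    and "P \<noteq> 0" and "rpoly_degree P = m"
  shows "full_rank_lattice \<Lambda> \<and> \<Lambda> \<subseteq> \<Omega> \<and> D \<le> (\<Prod>i=1..s. Ds i) \<and>
    (\<exists>z \<in> \<Omega> - (\<Union>i\<in>{1..s}. \<Lambda>s i).
       rpoly_eval P z \<noteq> 0 \<and> (\<forall>i. 0 \<le> z $ i) \<and>
       infnorm z < real D * (real m + 2) * (covering_radius \<Lambda> + 1) *
         (real D * \<Delta> / successive_min \<Lambda> 1 ^ (CARD('n) - 1) *
            ((\<Sum>i=1..s. 1 / real (Ds i)) - (real s - 1) / real D
              + successive_min \<Lambda> 1 ^ CARD('n) / (real D * \<Delta>))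
          + (\<Sum>i=1..CARD('n). successive_min \<Lambda> i)))"
proof -
  note \<Omega> = assms(1) and \<Lambda>s = assms(4) and sub = assms(5) and \<Lambda> = assms(7)
  have subgroup: "add_subgroup (\<Lambda>s i)" if "i \<in> {1..s}" for i
    using \<Lambda>s[OF that] by (rule full_rank_lattice_subgroup)
  have \<Omega>_subgroup: "add_subgroup \<Omega>"
    using \<Omega> by (rule full_rank_lattice_subgroup)
  have "\<exists>N::nat. 0 < N \<and> (\<forall>i\<in>{1..s}. \<forall>x\<in>\<Omega>. real N *\<^sub>R x \<in> \<Lambda>s i)"
    using subgroup sublattice_multiple[OF \<Omega> \<Lambda>s sub]
    by (intro common_multiple) auto
  then obtain N :: nat where N: "0 < N" "\<And>i x. i \<in> {1..s} \<Longrightarrow> x \<in> \<Omega> \<Longrightarrow> real N *\<^sub>R x \<in> \<Lambda>s i"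
    by blast
  have N\<Lambda>: "real N *\<^sub>R x \<in> \<Lambda>" if "x \<in> \<Omega>" for x
    using N(2) that by (simp add: \<Lambda>)
  have \<Lambda>_subgroup: "add_subgroup \<Lambda>"
    using subgroup by (auto simp: \<Lambda> add_subgroup_def)
  \<comment> \<open>\<open>1 \<le> s\<close> provides an index; an empty intersection would be the
    whole space.\<close>
  have \<Lambda>_sub: "\<Lambda> \<subseteq> \<Omega>"
    using sub[of 1] \<open>1 \<le> s\<close> by (auto simp: \<Lambda>)
  have full: "full_rank_lattice \<Lambda>"
    using full_rank_sublattice[OF \<Omega> \<Lambda>_subgroup \<Lambda>_sub N(1) N\<Lambda>] .
  have fin: "finite ((\<lambda>x. (+) x ` \<Lambda>) ` \<Omega>)"
    using finite_cosets[OF \<Omega> \<Lambda>_subgroup N(1) N\<Lambda>] .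
  have fins: "finite ((\<lambda>x. (+) x ` \<Lambda>s i) ` \<Omega>)" if "i \<in> {1..s}" for i
    using finite_cosets[OF \<Omega> subgroup[OF that] N(1) N(2)[OF that]] .
  have Dle: "D \<le> (\<Prod>i=1..s. Ds i)"
    using lattice_index_Inter[of "{1..s}" \<Lambda>s \<Omega>] subgroup fins assms(6,8) by (simp add: \<Lambda>)
  have \<Omega>_ne: "\<Omega> \<noteq> {}"
    using add_subgroupD(1)[OF \<Omega>_subgroup] by auto
  have D: "0 < D"
    unfolding assms(8)[symmetric] lattice_index_def using fin \<Omega>_ne by (simp add: card_gt_0_iff)
  have Ds: "0 < Ds i \<and> Ds i \<le> D" if i: "i \<in> {1..s}" for i
  proof
    show "0 < Ds i"
      unfolding assms(6)[OF i, symmetric] lattice_index_def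
      using fins[OF i] \<Omega>_ne by (simp add: card_gt_0_iff)
    have "\<Lambda> \<subseteq> \<Lambda>s i"
      using i by (auto simp: \<Lambda>)
    then show "Ds i \<le> D"
      unfolding assms(6)[OF i, symmetric] assms(8)[symmetric]
      using subgroup[OF i] add_subgroupD(1)[OF \<Lambda>_subgroup] fin by (intro lattice_index_antimono)
  qed
  have \<Delta>: "0 < \<Delta>"
  proof -
    obtain B where B: "lattice_basis B \<Omega>"
      using \<Omega> by (auto simp: full_rank_lattice_def)
    then have "det B \<noteq> 0"
      by (simp add: lattice_basis_def invertible_det_nz)
    then show ?thesis
      using lattice_det_eq[OF B] assms(2) by simp
  qed
  have min_pos: "0 < successive_min \<Lambda> i" if "i \<in> {1..CARD('n)}" for i
    using successive_min_attained[OF full] that by simp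
  define S where "S = (\<Sum>i=1..CARD('n). successive_min \<Lambda> i)"
  have S: "0 < S"
    unfolding S_def using min_pos by (intro sum_pos) auto
  obtain x where x: "x \<in> \<Omega>" "x \<notin> (\<Union>i\<in>{1..s}. \<Lambda>s i)"
    using assms(9) by blast
  obtain l where l: "l \<in> \<Lambda>" "rpoly_eval P (x + l) \<noteq> 0" "\<forall>i. 0 \<le> (x + l) $ i"
    "infnorm (x + l) \<le> (real m + 1) * S"
    using coset_point_nonvanishing[OF full \<open>P \<noteq> 0\<close>, of x] unfolding S_def assms(11) by blast
  have "x + l \<in> \<Omega>"
    using x(1) l(1) \<Lambda>_sub add_subgroupD(4)[OF \<Omega>_subgroup] by blast
  moreover have "x + l \<notin> \<Lambda>s i" if i: "i \<in> {1..s}" for i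
  proof
    assume "x + l \<in> \<Lambda>s i"
    moreover have "l \<in> \<Lambda>s i"
      using l(1) i by (auto simp: \<Lambda>)
    ultimately have "x \<in> \<Lambda>s i"
      using add_subgroupD(2)[OF subgroup[OF i], of "x + l" l] by simp
    then show False
      using x(2) i by blast
  qed
  moreover have "infnorm (x + l) < real D * (real m + 2) * (covering_radius \<Lambda> + 1) *
         (real D * \<Delta> / successive_min \<Lambda> 1 ^ (CARD('n) - 1) *
            ((\<Sum>i=1..s. 1 / real (Ds i)) - (real s - 1) / real D
              + successive_min \<Lambda> 1 ^ CARD('n) / (real D * \<Delta>)) + S)"
  proof -
    define X where "X = real D * \<Delta> / successive_min \<Lambda> 1 ^ (CARD('n) - 1) *
            ((\<Sum>i=1..s. 1 / real (Ds i)) - (real s - 1) / real D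
              + successive_min \<Lambda> 1 ^ CARD('n) / (real D * \<Delta>))"
    \<comment> \<open>From \<open>Ds i \<le> D\<close> the sum of the reciprocals is at least
      \<open>s / D\<close>, which exceeds the subtracted term \<open>(s - 1) / D\<close>.\<close>
    have "(\<Sum>i=1..s. 1 / real D) \<le> (\<Sum>i=1..s. 1 / real (Ds i))"
      using Ds by (intro sum_mono frac_le) auto
    then have "(real s - 1) / real D \<le> (\<Sum>i=1..s. 1 / real (Ds i))"
      using D by (simp add: diff_divide_distrib) (smt (verit) divide_nonneg_nonneg of_nat_0_le_iff)
    moreover have "0 < successive_min \<Lambda> 1"
      using min_pos[of 1] by simp
    ultimately have X: "0 \<le> X"
      unfolding X_def using D \<Delta> by (intro mult_nonneg_nonneg add_nonneg_nonneg) auto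
    \<comment> \<open>Strictness comes from \<open>m + 1 < m + 2\<close> and \<open>0 < S\<close>;
      the remaining estimates need not be strict.\<close>
    have "infnorm (x + l) < (real m + 2) * S"
      using l(4) S by (simp add: algebra_simps)
    also have "\<dots> \<le> (real m + 2) * (X + S)"
      using X by (intro mult_left_mono) auto
    also have "\<dots> = (1 * (real m + 2)) * 1 * (X + S)"
      by simp
    \<comment> \<open>The factors \<open>D\<close> and \<open>covering_radius \<Lambda> + 1\<close>
      are at least 1, the latter by positivity of the covering radius.\<close>
    also have "\<dots> \<le> (real D * (real m + 2)) * (covering_radius \<Lambda> + 1) * (X + S)"
      using D X S covering_radius_pos[OF full] by (intro mult_mono) auto
    finally show ?thesis
      unfolding X_def .
  qed
  ultimately show ?thesis
    using full \<Lambda>_sub Dle l(2,3) unfolding S_def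
    by (intro conjI bexI[of _ "x + l"]) auto
qed

end
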